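(* For every instance $(m,\mathcal{J})$ of the LexOpt scheduling problem, the LexOpt branch-and-bound algorithm with vectorial bounds (described in the context) terminates with an incumbent $I$ that is a LexOpt solution, i.e. a schedule with $\vec C(I)\le_{\mathrm{lex}}\vec C(S)$ for every schedule $S$ of the instance.
   Context: Problem. An instance $(m,\mathcal{J})$ consists of $m\ge1$ identical machines $M_1,\dots,M_m$ and jobs $J_1,\dots,J_n$, $n\ge 1$, with processing times $p_j>0$. A schedule $S$ assigns each job to exactly one machine; the completion time of a machine is the sum of the processing times of its jobs. $\vec C(S)=(C_1(S),\dots,C_m(S))$ denotes the vector of machine completion times of a complete schedule sorted in non-increasing order. $\le_{\mathrm{lex}}$ and $<_{\mathrm{lex}}$ are the usual lexicographic orders on vectors. A LexOpt solution is a schedule minimizing $\vec C$ lexicographically. Search tree. Number the jobs so that $p_1\ge\dots\ge p_n$ and set $p_{n+1}=0$. The tree has levels $0,\dots,n$; a node $v$ at level $\ell$ is an assignment of $J_1,\dots,J_\ell$ to $M_1,\dots,M_m$ (the root is the empty assignment), and if $\ell<n$ it has $m$ children, one for each machine to which $J_{\ell+1}$ can be assigned. Leaves are complete schedules. For a node $v$, $t_q$ is the total processing time of the jobs among $J_1,\dots,J_\ell$ that $v$ assigns to $M_q$. Primal heuristic (LPT) at $v$: keep the assignment of $v$ and assign $J_{\ell+1},\dots,J_n$ in this order, each to a currently least loaded machine. Vectorial bounds at a node $v$ of level $\ell\in\{1,\dots,n-1\}$, given the current incumbent $I$. For $i=1,\dots,m$ compute successively $L_i$ and $U_i$: - $L_i$: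 let $h$ be the smallest index $h\ge\ell$ with $\sum_{j=\ell+1}^{h}p_j\ge\sum_{q=1}^{i-1}(U_q-t_q)$ ($h=n$ if there is none), $\lambda=\sum_{j=h+1}^n p_j$, $\tau=\max_{i\le q\le m}t_q$; then $$L_i=\max\Big\{\min_{i\le q\le m}t_q+p_{h+1},\ \tau+\max\Big\{\tfrac{1}{m-i+1}\Big(\lambda-\sum_{q=i}^m(\tau-t_q)\Big),0\Big\}\Big\}.$$ - $U_i$: let $\lambda'=\sum_{j=\ell+1}^n p_j-\sum_{q=1}^{i-1}(L_q-t_q)$, let $t'_i\le\dots\le t'_m$ be the values $t_i,\dots,t_m$ sorted in non-decreasing order, $t'_{m+1}=+\infty$, and let $\mu\in\{i,\dots,m\}$ be the smallest index with $\tau':=\frac{1}{\mu-i+1}\big(\sum_{q=i}^{\mu}t'_q+\lambda'\big)\le t'_{\mu+1}$; then $$U_i=\min\{\max\{\tau'+p_\ell,\ t'_m\},\ C_i(I)\}.$$ Algorithm. Start with a stack containing only the root and with incumbent value $\vec C(I)=(+\infty,\dots,+\infty)$. While the stack is non-empty, remove the top node $u$ and for each child $v$ of $u$: if $v$ is a leaf with schedule $S$, replace $I$ by $S$ if $\vec C(S)<_{\mathrm{lex}}\vec C(I)$; otherwise, let $S$ be the LPT schedule at $v$, replace $I$ by $S$ if $\vec C(S)<_{\mathrm{lex}}\vec C(I)$, compute $\vec L=(L_1,\dots,L_m)$ at $v$, and discard $v$ if $\vec C(I)\le_{\mathrm{lex}}\vec L$, else push $v$ on the stack. The output is the final incumbent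 $I$. *)

theory Defs
  imports "HOL-Library.While_Combinator" "HOL-Library.Extended_Real"
begin

section \<open>Schedules and lexicographic optimality\<close>

text \<open>
  Machines are the numbers \<open>1, ..., m\<close>. An assignment of some of the jobs is a partial map from
  jobs to machines; it is a (complete) schedule if its domain is the whole job set.
\<close>

type_synonym 'j assignment = "'j \<Rightarrow> nat option"

definition schedule :: "nat \<Rightarrow> 'j set \<Rightarrow> 'j assignment \<Rightarrow> bool" where
  "schedule m J S \<longleftrightarrow> dom S = J \<and> ran S \<subseteq> {1..m}"

definition load :: "('j \<Rightarrow> real) \<Rightarrow> 'j assignment \<Rightarrow> nat \<Rightarrow> real" where
  "load p v q = (\<Sum>j\<in>{j. v j = Some q}. p j)"

definition completion_vector :: "nat \<Rightarrow> ('j \<Rightarrow> real) \<Rightarrow> 'j assignment \<Rightarrow> real list" where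
  "completion_vector m p S = rev (sort (map (load p S) [1..<Suc m]))"

text \<open>
  All vectors compared below have length \<open>m\<close>; on lists of equal length, the library relations
  \<^const>\<open>ord_class.lexordp\<close> and \<^const>\<open>ord_class.lexordp_eq\<close> are the usual strict and non-strict lexicographic orders.
\<close>

definition lexopt :: "nat \<Rightarrow> 'j set \<Rightarrow> ('j \<Rightarrow> real) \<Rightarrow> 'j assignment \<Rightarrow> bool" where
  "lexopt m J p I \<longleftrightarrow> schedule m J I \<and>
     (\<forall>S. schedule m J S \<longrightarrow>
        ord_class.lexordp_eq (completion_vector m p I) (completion_vector m p S))"

section \<open>Vectorial bounds\<close>

text \<open>
  In this section \<open>P k\<close> is the \<open>k\<close>-th largest processing time (\<open>1 \<le> k \<le> n\<close>) with
  \<open>P (n + 1) = 0\<close>, \<open>l\<close> is the level of the node, \<open>t q\<close> its load on machine \<open>q\<close>, and \<open>c\<close> is the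
  incumbent value, a 0-indexed list whose entries may be infinite.
\<close>

definition cut_index :: "nat \<Rightarrow> (nat \<Rightarrow> real) \<Rightarrow> nat \<Rightarrow> real \<Rightarrow> nat" where
  "cut_index n P l B =
     (if \<exists>h. l \<le> h \<and> h \<le> n \<and> B \<le> (\<Sum>j=l+1..h. P j)
      then LEAST h. l \<le> h \<and> h \<le> n \<and> B \<le> (\<Sum>j=l+1..h. P j)
      else n)"

definition lower_value ::
  "nat \<Rightarrow> nat \<Rightarrow> (nat \<Rightarrow> real) \<Rightarrow> nat \<Rightarrow> (nat \<Rightarrow> real) \<Rightarrow> real \<Rightarrow> nat \<Rightarrow> real" where
  "lower_value m n P l t B i =
     (let h = cut_index n P l B;
          lam = (\<Sum>j=h+1..n. P j);
          tau = Max (t ` {i..m})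
      in max (Min (t ` {i..m}) + P (h + 1))
             (tau + max (1 / real (m - i + 1) * (lam - (\<Sum>q=i..m. tau - t q))) 0))"

text \<open>
  In \<open>upper_value\<close>, \<open>t' i \<le> ... \<le> t' m\<close> are the sorted values of \<open>t i, ..., t m\<close>; the convention
  that \<open>t' (m + 1)\<close> is infinite is the disjunct \<open>\<mu> = m\<close>. The minimum is always finite,
  since \<open>c\<close> has no entry \<open>-\<infinity>\<close>.
\<close>

definition upper_value ::
  "nat \<Rightarrow> nat \<Rightarrow> (nat \<Rightarrow> real) \<Rightarrow> nat \<Rightarrow> (nat \<Rightarrow> real) \<Rightarrow> ereal list \<Rightarrow> real \<Rightarrow> nat \<Rightarrow> real" where
  "upper_value m n P l t c A i =
     (let lam' = (\<Sum>j=l+1..n. P j) - A;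
          t' = (\<lambda>q. sort (map t [i..<Suc m]) ! (q - i));
          tau' = (\<lambda>\<mu>. 1 / real (\<mu> - i + 1) * ((\<Sum>q=i..\<mu>. t' q) + lam'));
          \<mu> = (LEAST \<mu>. i \<le> \<mu> \<and> \<mu> \<le> m \<and> (\<mu> = m \<or> tau' \<mu> \<le> t' (\<mu> + 1)))
      in real_of_ereal (min (ereal (max (tau' \<mu> + P l) (t' m))) (c ! (i - 1))))"

fun lower_bound upper_bound ::
  "nat \<Rightarrow> nat \<Rightarrow> (nat \<Rightarrow> real) \<Rightarrow> nat \<Rightarrow> (nat \<Rightarrow> real) \<Rightarrow> ereal list \<Rightarrow> nat \<Rightarrow> real" where
  "lower_bound m n P l t c i =
     lower_value m n P l t (\<Sum>q\<in>{1..<i}. upper_bound m n P l t c q - t q) i"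
| "upper_bound m n P l t c i =
     upper_value m n P l t c (\<Sum>q\<in>{1..<i}. lower_bound m n P l t c q - t q) i"

text \<open>The defining equations loop as rewrite rules.\<close>

declare lower_bound.simps [simp del] upper_bound.simps [simp del]

section \<open>Branch and bound\<close>

text \<open>
  Common parameters: \<open>\<sigma> 1, ..., \<sigma> n\<close> numbers the \<open>n\<close> jobs by non-increasing processing
  time; \<open>children u\<close> is the order in which the machines are tried at node \<open>u\<close>; \<open>pick v w\<close> is
  the least loaded machine that the heuristic started at \<open>v\<close> selects at the partial assignment
  \<open>w\<close>. The last two resolve the choices that the algorithm leaves open; as every node is
  generated at most once, letting them depend on nodes covers every possible run.
\<close>

definition numbering :: "'j set \<Rightarrow> ('j \<Rightarrow> real) \<Rightarrow> (nat \<Rightarrow> 'j) \<Rightarrow> bool" where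
  "numbering J p \<sigma> \<longleftrightarrow> bij_betw \<sigma> {1..card J} J \<and>
     (\<forall>i j. 1 \<le> i \<longrightarrow> i \<le> j \<longrightarrow> j \<le> card J \<longrightarrow> p (\<sigma> j) \<le> p (\<sigma> i))"

definition least_loaded :: "nat \<Rightarrow> ('j \<Rightarrow> real) \<Rightarrow> 'j assignment \<Rightarrow> nat \<Rightarrow> bool" where
  "least_loaded m p v q \<longleftrightarrow> q \<in> {1..m} \<and> (\<forall>r\<in>{1..m}. load p v q \<le> load p v r)"

definition level :: "'j assignment \<Rightarrow> nat" where
  "level v = card (dom v)"

definition child :: "(nat \<Rightarrow> 'j) \<Rightarrow> 'j assignment \<Rightarrow> nat \<Rightarrow> 'j assignment" where
  "child \<sigma> u q = u(\<sigma> (level u + 1) \<mapsto> q)"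

definition lpt ::
  "nat \<Rightarrow> (nat \<Rightarrow> 'j) \<Rightarrow> ('j assignment \<Rightarrow> 'j assignment \<Rightarrow> nat) \<Rightarrow> 'j assignment \<Rightarrow> 'j assignment" where
  "lpt n \<sigma> pick v = ((\<lambda>w. child \<sigma> w (pick v w)) ^^ (n - level v)) v"

definition incumbent_value ::
  "nat \<Rightarrow> ('j \<Rightarrow> real) \<Rightarrow> 'j assignment option \<Rightarrow> ereal list" where
  "incumbent_value m p I =
     (case I of None \<Rightarrow> replicate m \<infinity> | Some S \<Rightarrow> map ereal (completion_vector m p S))"

definition update_incumbent ::
  "nat \<Rightarrow> ('j \<Rightarrow> real) \<Rightarrow> 'j assignment \<Rightarrow> 'j assignment option \<Rightarrow> 'j assignment option" where
  "update_incumbent m p S I =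
     (if ord_class.lexordp (map ereal (completion_vector m p S)) (incumbent_value m p I)
      then Some S else I)"

definition lower_vector ::
  "nat \<Rightarrow> nat \<Rightarrow> ('j \<Rightarrow> real) \<Rightarrow> (nat \<Rightarrow> 'j) \<Rightarrow> 'j assignment \<Rightarrow> 'j assignment option \<Rightarrow> real list"
where
  "lower_vector m n p \<sigma> v I =
     map (lower_bound m n (\<lambda>k. if k \<in> {1..n} then p (\<sigma> k) else 0) (level v) (load p v)
            (incumbent_value m p I))
         [1..<Suc m]"

type_synonym 'j state = "'j assignment list \<times> 'j assignment option"

definition process_child ::
  "nat \<Rightarrow> nat \<Rightarrow> ('j \<Rightarrow> real) \<Rightarrow> (nat \<Rightarrow> 'j) \<Rightarrow> ('j assignment \<Rightarrow> 'j assignment \<Rightarrow> nat) \<Rightarrow>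
   'j assignment \<Rightarrow> 'j state \<Rightarrow> 'j state" where
  "process_child m n p \<sigma> pick v = (\<lambda>(stack, I).
     if level v = n then (stack, update_incumbent m p v I)
     else let I' = update_incumbent m p (lpt n \<sigma> pick v) I
          in if ord_class.lexordp_eq (incumbent_value m p I') (map ereal (lower_vector m n p \<sigma> v I'))
             then (stack, I')
             else (v # stack, I'))"

definition expand_top ::
  "nat \<Rightarrow> nat \<Rightarrow> ('j \<Rightarrow> real) \<Rightarrow> (nat \<Rightarrow> 'j) \<Rightarrow> ('j assignment \<Rightarrow> nat list) \<Rightarrow>
   ('j assignment \<Rightarrow> 'j assignment \<Rightarrow> nat) \<Rightarrow> 'j state \<Rightarrow> 'j state" where
  "expand_top m n p \<sigma> children pick = (\<lambda>(stack, I).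
     fold (process_child m n p \<sigma> pick)
          (map (child \<sigma> (hd stack)) (children (hd stack)))
          (tl stack, I))"

text \<open>
  \<^const>\<open>while_option\<close> returns \<open>None\<close> exactly if the loop does not terminate.
\<close>

definition branch_and_bound ::
  "nat \<Rightarrow> nat \<Rightarrow> ('j \<Rightarrow> real) \<Rightarrow> (nat \<Rightarrow> 'j) \<Rightarrow> ('j assignment \<Rightarrow> nat list) \<Rightarrow>
   ('j assignment \<Rightarrow> 'j assignment \<Rightarrow> nat) \<Rightarrow> 'j state option" where
  "branch_and_bound m n p \<sigma> children pick =
     while_option (\<lambda>(stack, I). stack \<noteq> []) (expand_top m n p \<sigma> children pick) ([Map.empty], None)"

end

theory Submission
  imports Defs "HOL-Library.Multiset"
begin

text \<open>
  The bounds are not valid for every schedule below a node, since they tie the \<open>i\<close>-th largest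
  completion time to machine \<open>i\<close>. They are valid along the path to a LexOpt schedule \<open>S\<close> whose
  machine loads are non-increasing in the machine index; permuting machines shows that such an
  \<open>S\<close> exists. Let \<open>v\<close> be a node on this path, \<open>I\<close> an incumbent with \<open>C(S) < C(I)\<close>, and \<open>k\<close> the
  first position where the two differ. By induction on \<open>i \<le> k\<close>, \<open>L i \<le> C i (S) \<le> U i\<close>: the lower
  bound is a volume argument, and the upper bound follows because moving a single job in \<open>S\<close>
  from machine \<open>i\<close> to one that ends at or below the water level does not improve \<open>S\<close>. Hence
  \<open>L\<close> precedes \<open>C(I)\<close> and \<open>v\<close> is not discarded. So at any time either \<open>I\<close> is optimal or the
  stack contains a node on the path to \<open>S\<close>.
\<close>

section \<open>Lexicographic comparison of sorted vectors\<close>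

lemma lexordp_map_iff:
  fixes f :: "'a::linorder \<Rightarrow> 'b::linorder"
  assumes "strict_mono f"
  shows "ord_class.lexordp (map f xs) (map f ys) \<longleftrightarrow> ord_class.lexordp xs ys"
proof (induction xs arbitrary: ys)
  case Nil
  then show ?case by simp
next
  case (Cons x xs)
  then show ?case using assms by (cases ys) (auto simp: strict_mono_less)
qed

lemma strict_mono_ereal: "strict_mono ereal"
  by (simp add: strict_mono_def)

lemma lexordp_eq_map_ereal_iff:
  "ord_class.lexordp_eq (map ereal xs) (map ereal ys) \<longleftrightarrow> ord_class.lexordp_eq xs ys"
  by (metis lexordp_map_iff[OF strict_mono_ereal] lexordp_eq_linear lexordp_eq_antisym
      lexordp_conv_lexordp_eq)

text \<open>Before position \<open>k\<close> a weak inequality is enough: if it is strict somewhere,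
  the comparison is already decided there in the same direction.\<close>

lemma lexordp_nthI:
  fixes xs ys :: "'a::linorder list"
  assumes "k < length xs" "k < length ys" "\<And>j. j < k \<Longrightarrow> xs ! j \<le> ys ! j" "xs ! k < ys ! k"
  shows "ord_class.lexordp xs ys"
  using assms
proof (induction k arbitrary: xs ys)
  case 0
  then show ?case by (cases xs; cases ys) auto
next
  case (Suc k)
  obtain x xs' where [simp]: "xs = x # xs'" using Suc.prems(1) by (cases xs) simp_all
  obtain y ys' where [simp]: "ys = y # ys'" using Suc.prems(2) by (cases ys) simp_all
  have "x \<le> y" using Suc.prems(3)[of 0] by simp
  moreover have "ord_class.lexordp xs' ys'"
    using Suc.prems Suc.prems(3)[of "Suc j" for j] by (intro Suc.IH) auto
  ultimately show ?case by auto
qed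

lemma lexordp_nthE:
  fixes xs ys :: "'a::linorder list"
  assumes "ord_class.lexordp xs ys" "length xs = length ys"
  obtains k where "k < length xs" "\<And>j. j < k \<Longrightarrow> xs ! j = ys ! j" "xs ! k < ys ! k"
proof -
  from assms obtain us a b vs ws where "a < b" and xs: "xs = us @ a # vs" and ys: "ys = us @ b # ws"
    by (auto simp: lexordp_iff)
  then show thesis
    by (intro that[of "length us"]) (auto simp: nth_append)
qed

text \<open>Entries above \<open>x\<close> agree on both sides, while \<open>x\<close> itself occurs
  strictly more often under \<open>g\<close>. The sorted vectors thus share the entries above
  \<open>x\<close> and all copies of \<open>x\<close> under \<open>f\<close>; next comes an entry
  below \<open>x\<close> for \<open>f\<close>, but another \<open>x\<close> for \<open>g\<close>. In
  the application \<open>x\<close> is the old load of a machine that loses a job.\<close>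

lemma lexordp_rev_sort:
  fixes f g :: "'a \<Rightarrow> 'b::linorder"
  assumes "\<And>k. k \<in> set ks \<Longrightarrow> f k = g k \<or> f k < x \<and> g k \<le> x"
    and "i \<in> set ks" "f i < x" "g i = x"
  shows "ord_class.lexordp (rev (sort (map f ks))) (rev (sort (map g ks)))"
proof -
  have decompose: "rev (sort zs) = rev (sort (filter (\<lambda>z. x < z) zs)) @
      replicate (length (filter (\<lambda>z. z = x) zs)) x @ rev (sort (filter (\<lambda>z. z < x) zs))"
    for zs :: "'b list"
  proof -
    have "sort zs = sort (filter (\<lambda>z. z < x) zs) @ replicate (length (filter (\<lambda>z. z = x) zs)) x @
        sort (filter (\<lambda>z. x < z) zs)"
    proof (rule properties_for_sort)
      show "mset (sort (filter (\<lambda>z. z < x) zs) @ replicate (length (filter (\<lambda>z. z = x) zs)) x @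
        sort (filter (\<lambda>z. x < z) zs)) = mset zs"
        by (induction zs) (auto simp: not_less_iff_gr_or_eq)
    qed (auto simp: sorted_append)
    then show ?thesis by simp
  qed
  have above: "filter (\<lambda>z. x < z) (map f ks) = filter (\<lambda>z. x < z) (map g ks)"
    using assms(1) by (induction ks) force+
  let ?eq = "\<lambda>f ks. length (filter (\<lambda>z. z = x) (map f ks))"
  have le: "?eq f js \<le> ?eq g js" if "set js \<subseteq> set ks" for js
    using that
  proof (induction js)
    case (Cons k js)
    then show ?case using assms(1)[of k] by auto
  qed simp
  have "?eq f js < ?eq g js" if "set js \<subseteq> set ks" "i \<in> set js" for js
    using that
  proof (induction js)
    case (Cons k js)
    then show ?case using assms(1)[of k] assms(3,4) le[of js] by (cases "i = k") auto
  qed simp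
  then have "?eq f ks < ?eq g ks" using assms(2) by blast
  then obtain d where d: "?eq g ks = ?eq f ks + Suc d"
    by (metis less_natE add_Suc_right)
  let ?below = "rev (sort (filter (\<lambda>z. z < x) (map f ks)))"
  \<comment> \<open>The strict inequality needs an actual entry of \<open>f\<close> after its copies
    of \<open>x\<close>; \<open>f i\<close> guarantees that there is one.\<close>
  have "f i \<in> set ?below" using assms(2,3) by simp
  then obtain z zs where z: "?below = z # zs"
    by (cases ?below) simp_all
  then have "z \<in> set ?below" by (simp only: list.set_intros)
  then have "z < x" by simp
  moreover have "replicate (?eq g ks) x = replicate (?eq f ks) x @ x # replicate d x"
    unfolding d replicate_add by simp
  ultimately show ?thesis
    unfolding decompose[of "map f ks"] decompose[of "map g ks"] above z
    by (simp only: append_assoc append_Cons lexordp_append_leftI lexordp_append_left_rightI)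
qed

section \<open>Validity of the vectorial bounds\<close>

text \<open>Here \<open>t\<close> are the loads of a node at level \<open>l\<close> and
  \<open>C\<close> those of a complete schedule extending it, which puts the \<open>j\<close>-th job
  on machine \<open>a j\<close>. Jobs are represented by their positions. Optimality of the schedule
  enters only through \<open>exchange\<close>.\<close>

locale partial_assignment =
  fixes m n l :: nat and P t C :: "nat \<Rightarrow> real" and a :: "nat \<Rightarrow> nat"
  assumes level_pos: "1 \<le> l" and level_le: "l \<le> n"
    and machine: "j \<in> {l+1..n} \<Longrightarrow> a j \<in> {1..m}"
    and P_pos: "j \<in> {1..n} \<Longrightarrow> 0 < P j"
    and P_antimono: "\<lbrakk>1 \<le> i; i \<le> j; j \<le> n\<rbrakk> \<Longrightarrow> P j \<le> P i"
    and P_last: "P (n + 1) = 0"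
    and C_eq: "q \<in> {1..m} \<Longrightarrow> C q = t q + (\<Sum>j\<in>{j \<in> {l+1..n}. a j = q}. P j)"
    and C_antimono: "\<lbrakk>1 \<le> i; i \<le> j; j \<le> m\<rbrakk> \<Longrightarrow> C j \<le> C i"
    and exchange: "\<lbrakk>j \<in> {l+1..n}; r \<in> {1..m}\<rbrakk> \<Longrightarrow> C (a j) \<le> C r + P j"
begin

lemma sum_increments:
  assumes "Q \<subseteq> {1..m}"
  shows "(\<Sum>q\<in>Q. C q - t q) = (\<Sum>j\<in>{j \<in> {l+1..n}. a j \<in> Q}. P j)"
proof -
  have "(\<Sum>q\<in>Q. C q - t q) = (\<Sum>q\<in>Q. \<Sum>j\<in>{j \<in> {j \<in> {l+1..n}. a j \<in> Q}. a j = q}. P j)"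
    using assms by (intro sum.cong refl) (auto simp: C_eq intro!: sum.cong)
  also have "\<dots> = (\<Sum>j\<in>{j \<in> {l+1..n}. a j \<in> Q}. P j)"
    using assms by (intro sum.group) (auto intro: finite_subset)
  finally show ?thesis .
qed

lemma sum_all_increments: "(\<Sum>q\<in>{1..m}. C q - t q) = (\<Sum>j=l+1..n. P j)"
  using sum_increments[of "{1..m}"] machine by (simp cong: conj_cong) (auto intro!: sum.cong)

lemma sum_split_increments:
  assumes "1 \<le> i" "i \<le> m"
  shows "(\<Sum>q\<in>{1..<i}. C q - t q) + (\<Sum>q=i..m. C q - t q) = (\<Sum>j=l+1..n. P j)"
proof -
  have "{1..m} = {1..<i} \<union> {i..m}" using assms by auto
  then have "(\<Sum>q\<in>{1..m}. C q - t q) = (\<Sum>q\<in>{1..<i}. C q - t q) + (\<Sum>q=i..m. C q - t q)"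
    by (simp only:) (rule sum.union_disjoint, auto)
  then show ?thesis by (simp only: sum_all_increments)
qed

lemma P_nonneg: "j \<in> {l+1..n} \<Longrightarrow> 0 \<le> P j"
  using P_pos[of j] by simp

lemma load_le_C: "q \<in> {1..m} \<Longrightarrow> t q \<le> C q"
  using C_eq P_nonneg by (auto intro!: sum_nonneg)

lemma load_plus_job_le_C:
  assumes "j \<in> {l+1..n}"
  shows "t (a j) + P j \<le> C (a j)"
proof -
  have "P j \<le> (\<Sum>k\<in>{k \<in> {l+1..n}. a k = a j}. P k)"
    using assms P_nonneg by (intro member_le_sum) auto
  then show ?thesis using C_eq[OF machine[OF assms]] by simp
qed

text \<open>Since \<open>B\<close> overestimates what the machines before \<open>i\<close> still
  receive, the jobs up to the cut cover that volume, and at least \<open>lam\<close> remains for the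
  machines \<open>i, ..., m\<close>, all of which finish by \<open>C i\<close>.\<close>

lemma lower_value_le:
  assumes i: "1 \<le> i" "i \<le> m" and B: "(\<Sum>q\<in>{1..<i}. C q - t q) \<le> B"
  shows "lower_value m n P l t B i \<le> C i"
proof -
  define h where "h = cut_index n P l B"
  define lam where "lam = (\<Sum>j=h+1..n. P j)"
  define tau where "tau = Max (t ` {i..m})"
  \<comment> \<open>The case \<open>h = n\<close> includes the default of \<open>cut_index\<close>;
    it is harmless because then \<open>lam\<close> and \<open>P (h + 1)\<close> are both 0.\<close>
  have h: "l \<le> h" "h \<le> n" "h = n \<or> B \<le> (\<Sum>j=l+1..h. P j)"
    unfolding h_def cut_index_def
    using LeastI_ex[of "\<lambda>h. l \<le> h \<and> h \<le> n \<and> B \<le> (\<Sum>j=l+1..h. P j)"] level_le by auto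
  have C_le: "C q \<le> C i" if "q \<in> {i..m}" for q
    using C_antimono that i by simp
  have split: "(\<Sum>j=l+1..h. P j) + lam = (\<Sum>j=l+1..n. P j)"
  proof -
    have "{l+1..n} = {l+1..h} \<union> {h+1..n}" using h by auto
    then show ?thesis unfolding lam_def by (simp add: sum.union_disjoint)
  qed
  have lam_le: "lam \<le> (\<Sum>q=i..m. C q - t q)"
  proof (cases "h = n")
    case True
    then have "lam = 0" by (simp add: lam_def)
    moreover have "0 \<le> (\<Sum>q=i..m. C q - t q)"
      using load_le_C i by (intro sum_nonneg) auto
    ultimately show ?thesis by simp
  next
    case False
    then show ?thesis using h(3) B split sum_split_increments[OF i] by linarith
  qed
  have tau_le: "tau \<le> C i"
  proof -
    have "t q \<le> C i" if "q \<in> {i..m}" for q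
      using load_le_C[of q] C_le[OF that] that i by auto
    then show ?thesis unfolding tau_def using i by simp
  qed
  \<comment> \<open>The room below \<open>C i\<close> on the machines \<open>i, ..., m\<close> must
    hold the volume \<open>lam\<close>; dividing by the number of these machines gives the averaged
    bound.\<close>
  have avg: "tau + 1 / real (m - i + 1) * (lam - (\<Sum>q=i..m. tau - t q)) \<le> C i"
  proof -
    have "(\<Sum>q=i..m. C q) \<le> (\<Sum>q=i..m. C i)"
      using C_le by (intro sum_mono)
    then have "(\<Sum>q=i..m. C q) \<le> real (m - i + 1) * C i"
      using i by (simp add: Suc_diff_le)
    moreover have "(\<Sum>q=i..m. tau - t q) = real (m - i + 1) * tau - (\<Sum>q=i..m. t q)"
      using i by (simp add: sum_subtractf Suc_diff_le)
    ultimately have "lam - (\<Sum>q=i..m. tau - t q) \<le> (C i - tau) * real (m - i + 1)"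
      using lam_le by (simp add: sum_subtractf algebra_simps)
    then have "(lam - (\<Sum>q=i..m. tau - t q)) / real (m - i + 1) \<le> C i - tau"
      by (simp add: divide_le_eq)
    then show ?thesis by simp
  qed
  have min: "Min (t ` {i..m}) + P (h + 1) \<le> C i"
  proof -
    have "\<exists>q\<in>{i..m}. t q + P (h + 1) \<le> C q"
    proof (cases "h = n")
      case True
      then show ?thesis using P_last load_le_C[of i] i by (intro bexI[of _ i]) auto
    next
      case False
      \<comment> \<open>The jobs \<open>l+1, ..., h+1\<close> have total size greater than
        \<open>B\<close>, so they do not all fit on the machines before \<open>i\<close>. One that
        goes elsewhere is at least as large as job \<open>h+1\<close>.\<close>
      have "\<exists>j\<in>{l+1..h+1}. a j \<in> {i..m}"
      proof (rule ccontr)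
        assume "\<not> ?thesis"
        then have "a j \<in> {1..<i}" if "j \<in> {l+1..h+1}" for j
          using that machine[of j] h(2) False by force
        then have "{l+1..h+1} \<subseteq> {j \<in> {l+1..n}. a j \<in> {1..<i}}"
          using h(2) False by auto
        then have "(\<Sum>j=l+1..h+1. P j) \<le> (\<Sum>j\<in>{j \<in> {l+1..n}. a j \<in> {1..<i}}. P j)"
          using P_nonneg by (intro sum_mono2) auto
        also have "\<dots> = (\<Sum>q\<in>{1..<i}. C q - t q)"
          using i by (subst sum_increments) auto
        also have "\<dots> \<le> (\<Sum>j=l+1..h. P j)" using B h(3) False by simp
        also have "\<dots> < (\<Sum>j=l+1..h+1. P j)"
          using P_pos[of "h + 1"] h False by simp
        finally show False by simp
      qed
      then obtain j where j: "j \<in> {l+1..h+1}" "a j \<in> {i..m}" by blast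
      then have "t (a j) + P j \<le> C (a j)" "P (h + 1) \<le> P j"
        using load_plus_job_le_C[of j] P_antimono[of j "h + 1"] h False by auto
      then show ?thesis using j by (intro bexI[of _ "a j"]) auto
    qed
    then obtain q where q: "q \<in> {i..m}" "t q + P (h + 1) \<le> C q" by blast
    then have "Min (t ` {i..m}) \<le> t q" by simp
    then show ?thesis using q C_le[of q] by linarith
  qed
  show ?thesis
    unfolding lower_value_def Let_def h_def[symmetric] lam_def[symmetric] tau_def[symmetric]
    using tau_le avg min by (simp add: max_def)
qed

text \<open>Since \<open>A\<close> underestimates the volume taken by the machines before
  \<open>i\<close>, at most \<open>lam'\<close> is left for the others. Hence some machine ends at
  or below the water level \<open>tau' \<mu>\<close>, and \<open>exchange\<close> with a later job
  on machine \<open>i\<close> keeps \<open>C i\<close> within \<open>P l\<close> of that level. If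
  machine \<open>i\<close> gets no later job, its load is still \<open>t i\<close>.\<close>

lemma le_upper_value:
  assumes i: "1 \<le> i" "i \<le> m" and A: "A \<le> (\<Sum>q\<in>{1..<i}. C q - t q)"
    and c: "ereal (C i) \<le> c ! (i - 1)"
  shows "C i \<le> upper_value m n P l t c A i"
proof -
  \<comment> \<open>An incumbent entry may be infinite, but the minimum with a real number is finite
    here, so \<open>real_of_ereal\<close> preserves the inequality.\<close>
  have finite_min: "x \<le> real_of_ereal (min (ereal y) z)" if "x \<le> y" "ereal x \<le> z" for x y z
    using that by (cases z) (auto simp: min_def)
  define lam' where "lam' = (\<Sum>j=l+1..n. P j) - A"
  define t' where "t' = (\<lambda>q. sort (map t [i..<Suc m]) ! (q - i))"
  define tau' where "tau' = (\<lambda>\<mu>. 1 / real (\<mu> - i + 1) * ((\<Sum>q=i..\<mu>. t' q) + lam'))"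
  define \<mu> where "\<mu> = (LEAST \<mu>. i \<le> \<mu> \<and> \<mu> \<le> m \<and> (\<mu> = m \<or> tau' \<mu> \<le> t' (\<mu> + 1)))"
  have \<mu>: "i \<le> \<mu>" "\<mu> \<le> m"
    using LeastI[of "\<lambda>\<mu>. i \<le> \<mu> \<and> \<mu> \<le> m \<and> (\<mu> = m \<or> tau' \<mu> \<le> t' (\<mu> + 1))" m] i
    by (auto simp: \<mu>_def)
  \<comment> \<open>Sorting the machines instead of their loads makes each \<open>t' q\<close> the
    load of a definite machine.\<close>
  define ks where "ks = sort_key t [i..<Suc m]"
  have ks: "set ks = {i..m}" "distinct ks" "length ks = m - i + 1"
    using i by (auto simp: ks_def)
  have "sorted (map t ks)" "mset (map t ks) = mset (map t [i..<Suc m])"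
    by (simp_all add: ks_def del: upt_Suc)
  then have sort_eq: "sort (map t [i..<Suc m]) = map t ks"
    by (metis properties_for_sort)
  have t'_eq: "t' q = t (ks ! (q - i))" if "q \<in> {i..m}" for q
    using that i ks(3) unfolding t'_def sort_eq by (subst nth_map) auto
  have t_le_max: "t i \<le> t' m"
  proof -
    obtain k where "k < length ks" "i = ks ! k"
      using ks(1) i by (metis atLeastAtMost_iff in_set_conv_nth order_refl)
    then show ?thesis
      using sorted_nth_mono[OF \<open>sorted (map t ks)\<close>, of k "m - i"] ks(3) i t'_eq[of m] by auto
  qed
  \<comment> \<open>The machines carrying the \<open>\<mu> - i + 1\<close> smallest loads; filling
    them with \<open>lam'\<close> gives the average \<open>tau' \<mu>\<close>.\<close>
  define K where "K = (\<lambda>q. ks ! (q - i)) ` {i..\<mu>}"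
  have inj: "inj_on (\<lambda>q. ks ! (q - i)) {i..\<mu>}"
    using ks \<mu> by (auto simp: inj_on_def nth_eq_iff_index_eq)
  have K: "K \<subseteq> {i..m}"
    using ks \<mu> unfolding K_def by (auto simp flip: ks(1) intro!: nth_mem)
  have K_card: "card K = \<mu> - i + 1"
    using card_image[OF inj] \<mu> unfolding K_def by simp
  have "(\<Sum>q=i..\<mu>. t' q) = (\<Sum>q\<in>K. t q)"
    unfolding K_def sum.reindex[OF inj] using \<mu> by (intro sum.cong) (auto simp: t'_eq)
  then have tau'_eq: "real (card K) * tau' \<mu> = (\<Sum>q\<in>K. t q) + lam'"
    unfolding tau'_def K_card by simp
  \<comment> \<open>Otherwise the machines in \<open>K\<close> would receive more than the available volume \<open>lam'\<close>.\<close>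
  have "\<exists>r\<in>K. C r \<le> tau' \<mu>"
  proof (rule ccontr)
    assume "\<not> ?thesis"
    moreover have "finite K" "K \<noteq> {}" using K K_card finite_subset by fastforce+
    ultimately have "(\<Sum>q\<in>K. tau' \<mu>) < (\<Sum>q\<in>K. C q)"
      by (intro sum_strict_mono) auto
    then have "(\<Sum>q\<in>K. t q) + lam' < (\<Sum>q\<in>K. C q)" using tau'_eq by simp
    moreover have "(\<Sum>q\<in>K. C q - t q) \<le> (\<Sum>q=i..m. C q - t q)"
      using K load_le_C i by (intro sum_mono2) auto
    moreover have "\<dots> \<le> lam'" using sum_split_increments[OF i] A by (simp add: lam'_def)
    ultimately show False by (simp add: sum_subtractf)
  qed
  then obtain r where r: "r \<in> {1..m}" "C r \<le> tau' \<mu>" using K i(1) by (meson atLeastAtMost_iff order_trans subsetD)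
  have "C i \<le> max (tau' \<mu> + P l) (t' m)"
  proof (cases "\<exists>j\<in>{l+1..n}. a j = i")
    case True
    then obtain j where j: "j \<in> {l+1..n}" "a j = i" by blast
    then have "C i \<le> C r + P j" "P j \<le> P l"
      using exchange r(1) P_antimono[of l j] level_pos by auto
    then show ?thesis using r(2) by simp
  next
    case False
    then have empty: "{j \<in> {l+1..n}. a j = i} = {}" by auto
    have "C i = t i" using C_eq[of i] i unfolding empty by simp
    then show ?thesis using t_le_max by simp
  qed
  then have "C i \<le> real_of_ereal (min (ereal (max (tau' \<mu> + P l) (t' m))) (c ! (i - 1)))"
    using c finite_min by blast
  then show ?thesis
    unfolding upper_value_def Let_def lam'_def t'_def tau'_def \<mu>_def .
qed

text \<open>The two bounds need a joint induction: upper bounds on earlier machines provide the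
  overestimate \<open>B\<close> for the lower bound, and lower bounds on them provide the
  underestimate \<open>A\<close> for the upper bound.\<close>

lemma bounds_valid:
  assumes "\<And>i. 1 \<le> i \<Longrightarrow> i \<le> k \<Longrightarrow> ereal (C i) \<le> c ! (i - 1)" and "k \<le> m"
    and "1 \<le> i" "i \<le> k"
  shows "lower_bound m n P l t c i \<le> C i \<and> C i \<le> upper_bound m n P l t c i"
  using assms(3,4)
proof (induction i rule: less_induct)
  case (less i)
  then have IH: "lower_bound m n P l t c q \<le> C q" "C q \<le> upper_bound m n P l t c q"
    if "q \<in> {1..<i}" for q
    using that by auto
  show ?case
    unfolding lower_bound.simps[of m n P l t c i] upper_bound.simps[of m n P l t c i]
    using less.prems assms(1,2) IH by (intro conjI lower_value_le le_upper_value sum_mono) auto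
qed

end

section \<open>Schedules\<close>

locale scheduling_instance =
  fixes m :: nat and J :: "'j set" and p :: "'j \<Rightarrow> real" and \<sigma> :: "nat \<Rightarrow> 'j"
  assumes machines: "1 \<le> m"
    and finite_jobs: "finite J" and jobs_nonempty: "J \<noteq> {}"
    and p_pos: "j \<in> J \<Longrightarrow> 0 < p j"
    and numbering: "numbering J p \<sigma>"
begin

abbreviation n :: nat where
  "n \<equiv> card J"

text \<open>The same term as in \<open>lower_vector\<close>, so that facts about \<open>P\<close>
  apply to the algorithm directly. The value 0 outside the range supplies the convention for
  position \<open>n + 1\<close>.\<close>

abbreviation P :: "nat \<Rightarrow> real" where
  "P \<equiv> \<lambda>k. if k \<in> {1..n} then p (\<sigma> k) else 0"

section \<open>Nodes of the search tree\<close>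

definition node :: "'j assignment \<Rightarrow> bool" where
  "node v \<longleftrightarrow> level v \<le> n \<and> dom v = \<sigma> ` {1..level v} \<and> ran v \<subseteq> {1..m}"

lemma inj_\<sigma>: "inj_on \<sigma> {1..n}" and image_\<sigma> [simp]: "\<sigma> ` {Suc 0..n} = J"
  using numbering by (auto simp: numbering_def bij_betw_def)

lemma \<sigma>_in_J: "j \<in> {1..n} \<Longrightarrow> \<sigma> j \<in> J"
  using image_\<sigma> by (metis One_nat_def imageI)

lemma jobs_pos: "0 < n"
  using finite_jobs jobs_nonempty by (simp add: card_gt_0_iff)

lemma length_completion_vector [simp]: "length (completion_vector m p S) = m"
  by (simp add: completion_vector_def)

lemma node_empty: "node Map.empty" and level_empty: "level Map.empty = 0"
  by (simp_all add: node_def level_def)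

lemma
  assumes "node u" "level u < n" "q \<in> {1..m}"
  shows node_child: "node (child \<sigma> u q)" and level_child: "level (child \<sigma> u q) = Suc (level u)"
proof -
  have u: "dom u = \<sigma> ` {1..level u}" "ran u \<subseteq> {1..m}"
    using assms(1) by (auto simp: node_def)
  have dom: "dom (child \<sigma> u q) = insert (\<sigma> (Suc (level u))) (dom u)"
    by (simp add: child_def)
  have "finite (dom u)" unfolding u(1) by simp
  moreover have "\<sigma> (Suc (level u)) \<notin> dom u"
    unfolding u(1) by (subst inj_on_image_mem_iff[OF inj_\<sigma>]) (use assms(2) in auto)
  ultimately show level: "level (child \<sigma> u q) = Suc (level u)"
    unfolding level_def[of "child \<sigma> u q"] dom by (simp add: level_def)
  have "dom (child \<sigma> u q) = \<sigma> ` {1..level (child \<sigma> u q)}"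
    unfolding level dom u(1) by (simp add: atLeastAtMostSuc_conv)
  moreover have "ran (child \<sigma> u q) \<subseteq> {1..m}"
    using u(2) assms(3) by (auto simp: child_def ran_def)
  ultimately show "node (child \<sigma> u q)"
    using assms(2) level by (simp add: node_def)
qed

lemma schedule_iff_leaf: "schedule m J S \<longleftrightarrow> node S \<and> level S = n"
  by (cases "dom S = J") (auto simp: schedule_def node_def level_def)

lemma schedule_lpt:
  assumes "node v" and pick: "\<And>w. pick v w \<in> {1..m}"
  shows "schedule m J (lpt n \<sigma> pick v)"
proof -
  have "node (((\<lambda>w. child \<sigma> w (pick v w)) ^^ k) v) \<and>
      level (((\<lambda>w. child \<sigma> w (pick v w)) ^^ k) v) = level v + k" if "k \<le> n - level v" for k
    using that
  proof (induction k)
    case (Suc k)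
    then show ?case using node_child level_child pick by simp
  qed (simp add: assms(1))
  from this[of "n - level v"] show ?thesis
    using assms(1) by (simp add: schedule_iff_leaf lpt_def node_def)
qed

text \<open>Passes from jobs to their positions, the form of loads that
  \<open>partial_assignment\<close> expects.\<close>

lemma load_node:
  assumes "node v"
  shows "load p v q = (\<Sum>j\<in>{j \<in> {1..level v}. v (\<sigma> j) = Some q}. P j)"
proof -
  have le: "level v \<le> n" using assms by (simp add: node_def)
  have "{j. v j = Some q} = \<sigma> ` {j \<in> {1..level v}. v (\<sigma> j) = Some q}"
    using assms domI[of v _ q] by (fastforce simp: node_def)
  moreover have "inj_on \<sigma> {j \<in> {1..level v}. v (\<sigma> j) = Some q}"
    by (rule inj_on_subset[OF inj_\<sigma>]) (use le in auto)
  ultimately show ?thesis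
    unfolding load_def using le by (simp add: sum.reindex)
qed

section \<open>LexOpt schedules: exchange property and existence\<close>

text \<open>Otherwise moving \<open>j\<close> from \<open>q\<close> to \<open>r\<close> would lower
  the load of \<open>q\<close>, keep the load of \<open>r\<close> below the old load of
  \<open>q\<close>, and change nothing else. By \<open>lexordp_rev_sort\<close> the new schedule
  would be strictly better.\<close>

lemma lexopt_exchange:
  assumes opt: "lexopt m J p S" and j: "S j = Some q" and r: "r \<in> {1..m}"
  shows "load p S q \<le> load p S r + p j"
proof (rule ccontr)
  assume "\<not> ?thesis"
  then have less: "load p S r + p j < load p S q" by simp
  have S: "schedule m J S" using opt by (simp add: lexopt_def)
  have fin: "finite {k. S k = Some s}" for s
    by (rule finite_subset[of _ J]) (use S finite_jobs in \<open>auto simp: schedule_def\<close>)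
  have "j \<in> J" "q \<in> {1..m}" using S j by (auto simp: schedule_def ran_def)
  then have pj: "0 < p j" using p_pos by blast
  then have "q \<noteq> r" using less by auto
  define S' where "S' = S(j \<mapsto> r)"
  have "ran S' \<subseteq> {1..m}" "dom S' = J"
    using S r \<open>j \<in> J\<close> by (auto simp: S'_def schedule_def ran_def)
  then have "schedule m J S'" by (simp add: schedule_def)
  have load_q: "load p S' q = load p S q - p j"
  proof -
    have "{k. S' k = Some q} = {k. S k = Some q} - {j}"
      using \<open>q \<noteq> r\<close> by (auto simp: S'_def)
    then show ?thesis using fin j by (simp add: load_def sum_diff1)
  qed
  have load_r: "load p S' r = load p S r + p j"
  proof -
    have "{k. S' k = Some r} = insert j {k. S k = Some r}"
      by (auto simp: S'_def)
    then show ?thesis using fin j \<open>q \<noteq> r\<close> by (simp add: load_def)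
  qed
  have load_other: "load p S' s = load p S s" if "s \<noteq> q" "s \<noteq> r" for s
  proof -
    have "{k. S' k = Some s} = {k. S k = Some s}" using that j by (auto simp: S'_def)
    then show ?thesis by (simp add: load_def)
  qed
  have "ord_class.lexordp (completion_vector m p S') (completion_vector m p S)"
    unfolding completion_vector_def
  proof (rule lexordp_rev_sort[where x = "load p S q" and i = q])
    show "load p S' s = load p S s \<or> load p S' s < load p S q \<and> load p S s \<le> load p S q" for s
      using load_q load_r load_other[of s] pj less by (cases "s = q"; cases "s = r") auto
  qed (use load_q pj \<open>q \<in> {1..m}\<close> in auto)
  then show False
    using opt \<open>schedule m J S'\<close> by (auto simp: lexopt_def lexordp_conv_lexordp_eq)
qed

lemma ex_lexopt: "\<exists>S. lexopt m J p S"
proof -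
  \<comment> \<open>As a linear order, the lexicographic order has a minimal element on the finite
    nonempty set of completion vectors, and that element is a minimum.\<close>
  interpret lex: linorder "ord_class.lexordp_eq :: real list \<Rightarrow> _" ord_class.lexordp
    by (rule lexordp_linorder)
  let ?V = "completion_vector m p ` {S. schedule m J S}"
  \<comment> \<open>Putting every job on machine 1 shows that schedules exist.\<close>
  have "(\<lambda>j. if j \<in> J then Some 1 else None) \<in> {S. schedule m J S}"
    using machines by (auto simp: schedule_def ran_def dom_def)
  then have "?V \<noteq> {}" by blast
  moreover have "finite ?V"
    unfolding schedule_def by (intro finite_imageI finite_set_of_finite_maps finite_jobs) simp
  ultimately obtain x where "x \<in> ?V" "\<forall>y\<in>?V. ord_class.lexordp_eq y x \<longrightarrow> x = y"
    using lex.finite_has_minimal by blast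
  then have "\<forall>y\<in>?V. ord_class.lexordp_eq x y"
    by (metis lex.linear)
  then show ?thesis using \<open>x \<in> ?V\<close> by (auto simp: lexopt_def)
qed

section \<open>Schedules with sorted loads, and soundness of discarding\<close>

definition sorted_loads :: "'j assignment \<Rightarrow> bool" where
  "sorted_loads S \<longleftrightarrow> (\<forall>i j. 1 \<le> i \<longrightarrow> i \<le> j \<longrightarrow> j \<le> m \<longrightarrow> load p S j \<le> load p S i)"

lemma completion_vector_sorted:
  assumes "sorted_loads S"
  shows "completion_vector m p S = map (load p S) [1..<Suc m]"
proof -
  have "sorted (rev (map (load p S) [1..<Suc m]))"
    unfolding sorted_rev_iff_nth_mono
  proof (intro allI impI)
    fix i j assume "i \<le> j" "j < length (map (load p S) [1..<Suc m])"
    then show "map (load p S) [1..<Suc m] ! j \<le> map (load p S) [1..<Suc m] ! i"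
      using assms by (simp add: sorted_loads_def del: upt_Suc)
  qed
  then have "sort (map (load p S) [1..<Suc m]) = rev (map (load p S) [1..<Suc m])"
    by (intro properties_for_sort) simp_all
  then show ?thesis by (simp add: completion_vector_def)
qed

text \<open>Machines are identical, so renaming them by a permutation leaves the multiset of loads,
  and thus the completion vector, unchanged.\<close>

lemma ex_sorted_lexopt:
  obtains S where "lexopt m J p S" "sorted_loads S"
proof -
  obtain S where S: "lexopt m J p S" using ex_lexopt by blast
  then have sched: "schedule m J S" by (simp add: lexopt_def)
  define ms where "ms = rev (sort_key (load p S) [1..<Suc m])"
  have ms: "length ms = m" "set ms = {1..m}" "distinct ms"
    by (auto simp: ms_def simp del: upt_Suc)
  \<comment> \<open>\<open>g k\<close> is the machine with the \<open>k\<close>-th largest load; the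
    shift accounts for lists being indexed from 0. The new schedule renames machine
    \<open>g k\<close> to \<open>k\<close>.\<close>
  define g where "g k = ms ! (k - 1)" for k
  have inj: "inj_on g {1..m}"
    unfolding inj_on_def g_def using ms nth_eq_iff_index_eq[OF ms(3)] by fastforce
  have "g ` {1..m} \<subseteq> {1..m}"
    using ms nth_mem[of _ ms] by (auto simp: g_def)
  then have img: "g ` {1..m} = {1..m}"
    using inj by (simp add: endo_inj_surj)
  define S' where "S' j = map_option (the_inv_into {1..m} g) (S j)" for j
  have S'_iff: "S' j = Some k \<longleftrightarrow> S j = Some (g k)" if "k \<in> {1..m}" for j k
  proof (cases "S j")
    case (Some q)
    then have "q \<in> g ` {1..m}" using sched img by (auto simp: schedule_def ran_def)
    then show ?thesis
      using Some that inj the_inv_into_f_f[OF inj] by (auto simp: S'_def)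
  qed (simp add: S'_def)
  have loads: "load p S' k = load p S (g k)" if "k \<in> {1..m}" for k
    using that by (simp add: load_def S'_iff)
  have "dom S' = J" using sched by (auto simp: S'_def schedule_def)
  moreover have "ran S' \<subseteq> {1..m}"
  proof
    fix k assume "k \<in> ran S'"
    then obtain j q where q: "S j = Some q" "k = the_inv_into {1..m} g q"
      by (auto simp: S'_def ran_def)
    then have "q \<in> g ` {1..m}" using sched img by (auto simp: schedule_def ran_def)
    then show "k \<in> {1..m}" using the_inv_into_into[OF inj _ order_refl] q(2) by blast
  qed
  ultimately have sched': "schedule m J S'" by (simp add: schedule_def)
  have vec: "map (load p S') [1..<Suc m] = map (load p S) ms"
    using ms(1) by (intro nth_equalityI) (auto simp: loads g_def simp del: upt_Suc)
  have "mset (map (load p S) ms) = mset (map (load p S) [1..<Suc m])"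
    unfolding ms_def mset_map by (simp del: upt_Suc)
  then have "completion_vector m p S' = completion_vector m p S"
    unfolding completion_vector_def vec by (metis properties_for_sort mset_sort sorted_sort)
  then have "lexopt m J p S'" using S sched' by (simp add: lexopt_def)
  moreover have "sorted_loads S'"
    unfolding sorted_loads_def
  proof (intro allI impI)
    fix i j assume ij: "1 \<le> i" "i \<le> j" "j \<le> m"
    have "sorted (rev (map (load p S) ms))"
      by (simp add: ms_def rev_map del: upt_Suc)
    then have "map (load p S) ms ! (j - 1) \<le> map (load p S) ms ! (i - 1)"
      unfolding sorted_rev_iff_nth_mono using ij ms(1) by (auto intro: diff_le_mono)
    then show "load p S' j \<le> load p S' i"
      using ij ms(1) loads[of i] loads[of j] by (simp add: g_def)
  qed
  ultimately show thesis using that by blast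
qed

text \<open>If the vector of \<open>S\<close> were smaller than \<open>c\<close>, the bounds would
  be valid up to the first difference, which would put the lower bound vector strictly below
  \<open>c\<close> and so contradict the discarding test.\<close>

lemma discard_sound:
  assumes opt: "lexopt m J p S" and sorted: "sorted_loads S"
    and v: "node v" "v \<subseteq>\<^sub>m S" "1 \<le> level v"
    and c: "length c = m"
    and discard: "ord_class.lexordp_eq c
      (map ereal (map (lower_bound m n P (level v) (load p v) c) [1..<Suc m]))"
  shows "ord_class.lexordp_eq c (map ereal (completion_vector m p S))"
proof (rule ccontr)
  assume "\<not> ?thesis"
  then have "ord_class.lexordp (map ereal (completion_vector m p S)) c"
    by (meson lexordp_conv_lexordp_eq lexordp_eq_linear)
  \<comment> \<open>Vectors are indexed from 0 and machines from 1, so the first difference at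
    position \<open>k\<close> concerns machine \<open>Suc k\<close>.\<close>
  then obtain k where k: "k < m" "\<And>j. j < k \<Longrightarrow> map ereal (completion_vector m p S) ! j = c ! j"
      "map ereal (completion_vector m p S) ! k < c ! k"
    using c by (elim lexordp_nthE) auto
  have nth: "map ereal (completion_vector m p S) ! j = ereal (load p S (Suc j))" if "j < m" for j
    using that completion_vector_sorted[OF sorted] by (simp del: upt_Suc)
  have S: "schedule m J S" "node S" "level S = n"
    using opt by (auto simp: lexopt_def schedule_iff_leaf)
  have agree: "v (\<sigma> j) = S (\<sigma> j)" if "j \<in> {1..level v}" for j
    using that v(1,2) by (auto simp: node_def map_le_def)
  have "\<exists>q\<in>{1..m}. S (\<sigma> j) = Some q" if "j \<in> {1..n}" for j
  proof -
    have "\<sigma> j \<in> dom S" using S(1) \<sigma>_in_J[OF that] by (simp add: schedule_def)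
    then obtain q where "S (\<sigma> j) = Some q" by blast
    then show ?thesis using S(1) ranI[of S "\<sigma> j" q] by (auto simp: schedule_def)
  qed
  then obtain a where a: "\<And>j. j \<in> {1..n} \<Longrightarrow> a j \<in> {1..m} \<and> S (\<sigma> j) = Some (a j)"
    by metis
  have level: "level v \<le> n" using v(1) by (simp add: node_def)
  have "partial_assignment m n (level v) P (load p v) (load p S) a"
  proof
    show "P j \<le> P i" if "1 \<le> i" "i \<le> j" "j \<le> n" for i j
      using numbering that by (simp add: numbering_def)
    show "0 < P j" if "j \<in> {1..n}" for j
      using that p_pos \<sigma>_in_J by simp
    show "load p S j \<le> load p S i" if "1 \<le> i" "i \<le> j" "j \<le> m" for i j
      using sorted that by (simp add: sorted_loads_def)
    show "load p S q = load p v q + (\<Sum>j\<in>{j \<in> {level v + 1..n}. a j = q}. P j)" for q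
    proof -
      \<comment> \<open>The jobs of \<open>S\<close> on machine \<open>q\<close> split at the level
        of \<open>v\<close>: earlier ones are placed as in \<open>v\<close>, later ones as given by
        \<open>a\<close>.\<close>
      have "{j \<in> {1..n}. S (\<sigma> j) = Some q} =
          {j \<in> {1..level v}. v (\<sigma> j) = Some q} \<union> {j \<in> {level v + 1..n}. a j = q}"
        using agree a level by fastforce
      then show ?thesis
        unfolding load_node[OF S(2)] load_node[OF v(1)] S(3)
        by (simp only:) (rule sum.union_disjoint, auto)
    qed
    show "load p S (a j) \<le> load p S r + P j" if "j \<in> {level v + 1..n}" "r \<in> {1..m}" for j r
      using lexopt_exchange[OF opt, of "\<sigma> j" "a j" r] a[of j] that by auto
  qed (use v(3) level a in auto)
  then interpret partial_assignment m n "level v" P "load p v" "load p S" a .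
  \<comment> \<open>Equality holds before the first difference and strict inequality at it, so the
    incumbent entry in \<open>upper_value\<close> never cuts off the load of \<open>S\<close> on
    machines \<open>1, ..., Suc k\<close>.\<close>
  have c_ge: "ereal (load p S i) \<le> c ! (i - 1)" if "1 \<le> i" "i \<le> Suc k" for i
    using that k nth[of "i - 1"] by (cases "i - 1 = k") force+
  have lower_le: "lower_bound m n P (level v) (load p v) c i \<le> load p S i"
    if "1 \<le> i" "i \<le> Suc k" for i
    using bounds_valid[OF c_ge _ that] k(1) by simp
  have "ord_class.lexordp
      (map ereal (map (lower_bound m n P (level v) (load p v) c) [1..<Suc m])) c"
  proof (rule lexordp_nthI[of k])
    show "map ereal (map (lower_bound m n P (level v) (load p v) c) [1..<Suc m]) ! j \<le> c ! j"
      if "j < k" for j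
      using lower_le[of "Suc j"] c_ge[of "Suc j"] that k(1)
      by (simp del: upt_Suc) (meson ereal_less_eq(3) order_trans)
    show "map ereal (map (lower_bound m n P (level v) (load p v) c) [1..<Suc m]) ! k < c ! k"
      using lower_le[of "Suc k"] k(1,3) nth[of k]
      by (simp del: upt_Suc) (meson ereal_less_eq(3) order_le_less_trans)
  qed (use k(1) c in \<open>simp_all del: upt_Suc\<close>)
  then show False using discard lexordp_conv_lexordp_eq by blast
qed

end

section \<open>The branch-and-bound loop\<close>

text \<open>\<open>Opt\<close> is a fixed reference schedule for stating the loop invariant; the
  algorithm has no access to it.\<close>

locale branch_and_bound_run = scheduling_instance m J p \<sigma>
  for m :: nat and J :: "'j set" and p :: "'j \<Rightarrow> real" and \<sigma> :: "nat \<Rightarrow> 'j" +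
  fixes children :: "'j assignment \<Rightarrow> nat list"
    and pick :: "'j assignment \<Rightarrow> 'j assignment \<Rightarrow> nat"
    and Opt :: "'j assignment"
  assumes children: "distinct (children u)" "set (children u) = {1..m}"
    and pick: "pick v w \<in> {1..m}"
    and lexopt_Opt: "lexopt m J p Opt" and sorted_Opt: "sorted_loads Opt"
begin

abbreviation value_le :: "'j assignment option \<Rightarrow> 'j assignment option \<Rightarrow> bool" where
  "value_le I I' \<equiv> ord_class.lexordp_eq (incumbent_value m p I) (incumbent_value m p I')"

section \<open>Loop invariant and termination measure\<close>

definition valid_state :: "'j state \<Rightarrow> bool" where
  "valid_state = (\<lambda>(stack, I). (\<forall>v\<in>set stack. node v \<and> level v < n) \<and>
     (\<forall>S. I = Some S \<longrightarrow> schedule m J S))"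

text \<open>A node below \<open>Opt\<close> in the map order is a node on the path from the root to
  the leaf \<open>Opt\<close>.\<close>

definition opt_reachable :: "'j state \<Rightarrow> bool" where
  "opt_reachable = (\<lambda>(stack, I). value_le I (Some Opt) \<or> (\<exists>v\<in>set stack. v \<subseteq>\<^sub>m Opt))"

text \<open>With base \<open>m + 1\<close>, a node outweighs its \<open>m\<close> children together,
  so replacing it by any of them decreases the sum.\<close>

definition weight :: "'j state \<Rightarrow> nat" where
  "weight s = (\<Sum>v\<leftarrow>fst s. (m + 1) ^ (n - level v))"

section \<open>Effect of a step on incumbent, invariant and measure\<close>

lemma length_incumbent_value [simp]: "length (incumbent_value m p I) = m"
  by (simp add: incumbent_value_def split: option.split)

lemma update_incumbent_le:
  "value_le (update_incumbent m p S I) I" "value_le (update_incumbent m p S I) (Some S)"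
proof -
  have *: "ord_class.lexordp (map ereal (completion_vector m p S)) (incumbent_value m p I) \<or>
      value_le I (Some S)"
    by (simp add: incumbent_value_def) (meson lexordp_conv_lexordp_eq lexordp_eq_linear)
  then show "value_le (update_incumbent m p S I) I" "value_le (update_incumbent m p S I) (Some S)"
    unfolding update_incumbent_def
    by (auto simp: lexordp_eq_refl lexordp_into_lexordp_eq incumbent_value_def)
qed

lemma update_incumbent_schedule:
  assumes "schedule m J S" "\<forall>S'. I = Some S' \<longrightarrow> schedule m J S'"
  shows "\<forall>S'. update_incumbent m p S I = Some S' \<longrightarrow> schedule m J S'"
  using assms by (simp add: update_incumbent_def)

text \<open>Leaves and discarded nodes form one case: the node is not pushed, and if it lies on the
  path to \<open>Opt\<close>, the incumbent is now as good as \<open>Opt\<close>. A leaf on the path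
  is \<open>Opt\<close> itself; for a discarded node this is \<open>discard_sound\<close>.\<close>

lemma process_child_cases:
  assumes v: "node v" "1 \<le> level v" and I: "\<forall>S. I = Some S \<longrightarrow> schedule m J S"
  obtains I' where "\<forall>S. I' = Some S \<longrightarrow> schedule m J S" "value_le I' I"
    "process_child m n p \<sigma> pick v (stack, I) = (stack, I')" "v \<subseteq>\<^sub>m Opt \<Longrightarrow> value_le I' (Some Opt)"
  | I' where "\<forall>S. I' = Some S \<longrightarrow> schedule m J S" "value_le I' I"
    "process_child m n p \<sigma> pick v (stack, I) = (v # stack, I')" "level v < n"
proof (cases "level v = n")
  case True
  have "schedule m J v" using True v(1) by (simp add: schedule_iff_leaf)
  have v_eq: "v = Opt" if "v \<subseteq>\<^sub>m Opt"
  proof (rule map_le_antisym[OF that])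
    show "Opt \<subseteq>\<^sub>m v"
      using that \<open>schedule m J v\<close> lexopt_Opt
      by (auto simp: map_le_def lexopt_def schedule_def)
  qed
  show thesis
  proof (rule that(1))
    show "process_child m n p \<sigma> pick v (stack, I) = (stack, update_incumbent m p v I)"
      using True by (simp add: process_child_def)
    show "value_le (update_incumbent m p v I) (Some Opt)" if "v \<subseteq>\<^sub>m Opt"
      using v_eq[OF that] update_incumbent_le(2) by blast
  qed (rule update_incumbent_schedule[OF \<open>schedule m J v\<close> I] update_incumbent_le(1))+
next
  case False
  then have lt: "level v < n" using v(1) by (simp add: node_def)
  define I' where "I' = update_incumbent m p (lpt n \<sigma> pick v) I"
  have I': "\<forall>S. I' = Some S \<longrightarrow> schedule m J S" "value_le I' I"
    unfolding I'_def
    using update_incumbent_schedule[OF schedule_lpt[OF v(1) pick] I] update_incumbent_le by auto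
  show thesis
  proof (cases "ord_class.lexordp_eq (incumbent_value m p I')
      (map ereal (lower_vector m n p \<sigma> v I'))")
    case True
    \<comment> \<open>The bounds and the discarding test both use the incumbent after the heuristic
      has updated it.\<close>
    then have "value_le I' (Some Opt)" if "v \<subseteq>\<^sub>m Opt"
      using discard_sound[OF lexopt_Opt sorted_Opt v(1) that v(2), of "incumbent_value m p I'"]
      by (simp add: lower_vector_def incumbent_value_def[of m p "Some Opt"])
    then show thesis
      using True False I' by (intro that(1)[of I']) (simp_all add: process_child_def Let_def I'_def)
  next
    case False
    then show thesis
      using lt I' by (intro that(2)[of I']) (simp_all add: process_child_def Let_def I'_def)
  qed
qed

text \<open>Processing a child only adds to the stack and only improves the incumbent, so
  reachability of \<open>Opt\<close> cannot be lost; a child on the path establishes it by being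
  pushed or by the incumbent matching \<open>Opt\<close>.\<close>

lemma process_child_step:
  assumes v: "node v" "1 \<le> level v" and s: "valid_state s"
  shows "valid_state (process_child m n p \<sigma> pick v s) \<and>
    (opt_reachable s \<or> v \<subseteq>\<^sub>m Opt \<longrightarrow> opt_reachable (process_child m n p \<sigma> pick v s)) \<and>
    weight (process_child m n p \<sigma> pick v s) \<le> weight s + (m + 1) ^ (n - level v)"
proof -
  obtain stack I where s_eq: "s = (stack, I)" by (cases s)
  then have I: "\<forall>S. I = Some S \<longrightarrow> schedule m J S" and
    stack: "\<forall>v\<in>set stack. node v \<and> level v < n"
    using s by (auto simp: valid_state_def)
  show ?thesis
    using v I
  proof (cases rule: process_child_cases[of v I stack])
    case (1 I')
    then show ?thesis
      using stack unfolding s_eq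
      by (auto simp: valid_state_def opt_reachable_def weight_def intro: lexordp_eq_trans)
  next
    case (2 I')
    then show ?thesis
      using stack v(1) unfolding s_eq
      by (auto simp: valid_state_def opt_reachable_def weight_def intro: lexordp_eq_trans)
  qed
qed

lemma fold_process_child:
  assumes "\<forall>v\<in>set vs. node v \<and> level v = Suc k" "valid_state s"
  shows "valid_state (fold (process_child m n p \<sigma> pick) vs s) \<and>
    (opt_reachable s \<or> (\<exists>v\<in>set vs. v \<subseteq>\<^sub>m Opt) \<longrightarrow>
      opt_reachable (fold (process_child m n p \<sigma> pick) vs s)) \<and>
    weight (fold (process_child m n p \<sigma> pick) vs s) \<le> weight s + length vs * (m + 1) ^ (n - Suc k)"
  using assms
proof (induction vs arbitrary: s)
  case (Cons v vs)
  then have v: "node v" "1 \<le> level v" "level v = Suc k" by auto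
  note step = process_child_step[OF v(1,2) Cons.prems(2)]
  show ?case
    using Cons.IH[of "process_child m n p \<sigma> pick v s"] Cons.prems(1) step v(3) by auto
qed simp

text \<open>If the removed node lies on the path to \<open>Opt\<close>, so does its child for the
  machine on which \<open>Opt\<close> runs the next job, and that child takes over the
  invariant.\<close>

lemma expand_top_step:
  assumes s: "valid_state s" "opt_reachable s" and stack: "fst s \<noteq> []"
  shows "valid_state (expand_top m n p \<sigma> children pick s) \<and>
    opt_reachable (expand_top m n p \<sigma> children pick s) \<and>
    weight (expand_top m n p \<sigma> children pick s) < weight s"
proof -
  obtain u us I where s_eq: "s = (u # us, I)"
    using stack by (metis list.exhaust prod.collapse)
  then have u: "node u" "level u < n" and us: "valid_state (us, I)"
    using s(1) by (auto simp: valid_state_def)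
  define vs where "vs = map (child \<sigma> u) (children u)"
  have s'_eq: "expand_top m n p \<sigma> children pick s = fold (process_child m n p \<sigma> pick) vs (us, I)"
    by (simp add: expand_top_def s_eq vs_def)
  have vs: "\<forall>v\<in>set vs. node v \<and> level v = Suc (level u)"
    using node_child[OF u] level_child[OF u] children(2) by (auto simp: vs_def)
  have len: "length vs = m"
    using distinct_card[OF children(1)[of u]] children(2)[of u] by (simp add: vs_def)
  have "\<exists>v\<in>set vs. v \<subseteq>\<^sub>m Opt" if "u \<subseteq>\<^sub>m Opt"
  proof -
    have Opt: "schedule m J Opt" using lexopt_Opt by (simp add: lexopt_def)
    then have "\<sigma> (level u + 1) \<in> dom Opt"
      using \<sigma>_in_J[of "level u + 1"] u(2) by (simp add: schedule_def)
    then obtain q where q: "Opt (\<sigma> (level u + 1)) = Some q" by blast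
    then have "q \<in> {1..m}" using Opt ranI[of Opt "\<sigma> (level u + 1)" q] by (auto simp: schedule_def)
    moreover have "child \<sigma> u q \<subseteq>\<^sub>m Opt"
      using that q by (auto simp: child_def map_le_def)
    ultimately show ?thesis using children(2) by (auto simp: vs_def)
  qed
  then have "opt_reachable (us, I) \<or> (\<exists>v\<in>set vs. v \<subseteq>\<^sub>m Opt)"
    using s(2) by (auto simp: s_eq opt_reachable_def)
  \<comment> \<open>This is \<open>m * (m + 1) ^ k < (m + 1) ^ Suc k\<close> for
    \<open>k = n - Suc (level u)\<close>.\<close>
  moreover have "weight (us, I) + m * (m + 1) ^ (n - Suc (level u)) < weight s"
    using u(2) by (simp add: weight_def s_eq Suc_diff_Suc[symmetric])
  ultimately show ?thesis
    using fold_process_child[OF vs us] unfolding s'_eq len by auto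
qed

lemma branch_and_bound_correct:
  "\<exists>I. branch_and_bound m n p \<sigma> children pick = Some ([], Some I) \<and> lexopt m J p I"
proof -
  let ?inv = "\<lambda>s. valid_state s \<and> opt_reachable s"
  \<comment> \<open>The root is the empty map and hence lies below \<open>Opt\<close>; it is not a
    leaf because there is at least one job.\<close>
  have init: "?inv ([Map.empty], None)"
    using jobs_pos by (simp add: valid_state_def opt_reachable_def node_empty level_empty)
  have step: "?inv (expand_top m n p \<sigma> children pick s) \<and>
      weight (expand_top m n p \<sigma> children pick s) < weight s"
    if "?inv s" "case s of (stack, I) \<Rightarrow> stack \<noteq> []" for s
    using that expand_top_step[of s] by (auto split: prod.splits)
  have "\<exists>s. branch_and_bound m n p \<sigma> children pick = Some s"
    unfolding branch_and_bound_def
    by (rule measure_while_option_Some[where P = ?inv, OF step init])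
  then obtain stack I where result: "branch_and_bound m n p \<sigma> children pick = Some (stack, I)"
    by auto
  have "?inv (stack, I)"
    using while_option_rule[where P = ?inv, OF _ result[unfolded branch_and_bound_def] init] step
    by blast
  moreover have "stack = []"
    using while_option_stop[OF result[unfolded branch_and_bound_def]] by simp
  \<comment> \<open>With an empty stack, only the first alternative of \<open>opt_reachable\<close>
    remains.\<close>
  ultimately have le: "value_le I (Some Opt)" and sched: "\<forall>S. I = Some S \<longrightarrow> schedule m J S"
    by (auto simp: opt_reachable_def valid_state_def)
  \<comment> \<open>Without an incumbent the value would start with infinity, which exceeds the
    first entry of the vector of \<open>Opt\<close>; that entry exists since \<open>m\<close> is
    positive.\<close>
  have "I \<noteq> None"
  proof
    assume "I = None"
    moreover obtain x xs where "completion_vector m p Opt = x # xs"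
      using machines length_completion_vector[of Opt] by (cases "completion_vector m p Opt") auto
    ultimately show False
      using le machines by (cases m) (auto simp: incumbent_value_def)
  qed
  then obtain S where S: "I = Some S" by blast
  then have "ord_class.lexordp_eq (completion_vector m p S) (completion_vector m p Opt)"
    using le by (simp add: incumbent_value_def lexordp_eq_map_ereal_iff)
  then have "lexopt m J p S"
    using sched S lexopt_Opt by (auto simp: lexopt_def intro: lexordp_eq_trans)
  then show ?thesis using result S \<open>stack = []\<close> by blast
qed

end

theorem theorem1:
  fixes m :: nat and J :: "'j set" and p :: "'j \<Rightarrow> real" and \<sigma> :: "nat \<Rightarrow> 'j"
    and children :: "'j assignment \<Rightarrow> nat list" 
    and pick :: "'j assignment \<Rightarrow> 'j assignment \<Rightarrow> nat"
  assumes "1 \<le> m"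
    and "finite J" and "J \<noteq> {}"
    and "\<forall>j\<in>J. 0 < p j"
    and "numbering J p \<sigma>"
    and "\<forall>u. distinct (children u) \<and> set (children u) = {1..m}"
    and "\<forall>v w. least_loaded m p w (pick v w)"
  shows "\<exists>I. branch_and_bound m (card J) p \<sigma> children pick = Some ([], Some I) \<and> lexopt m J p I"
proof -
  interpret scheduling_instance m J p \<sigma>
    using assms(1-5) by unfold_locales auto
  obtain Opt where "lexopt m J p Opt" "sorted_loads Opt"
    by (rule ex_sorted_lexopt)
  then interpret branch_and_bound_run m J p \<sigma> children pick Opt
    using assms(6,7) by unfold_locales (simp_all add: least_loaded_def)
  show ?thesis by (rule branch_and_bound_correct)
qed

end
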